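(* Let $V$ and $U$ be independent standard normal random variables. For every Borel-measurable map $\phi\colon\mathbb{R}\to\mathbb{R}$, let $P_\phi\colon\mathbb{R}\to\mathbb{R}$ be a Borel version of the inverse regression $$P_\phi(y)=\mathbb{E}[V\mid \phi(V)+U=y],$$ and let $$F_\phi(x):=\mathbb{E}[P_\phi(x+U)],\qquad x\in\mathbb{R}.$$ Then the pointwise maximisation condition $$\phi(v)\in\operatorname*{arg\,max}_{x\in\mathbb{R}}\big(xv-xF_\phi(x)\big)\qquad\text{for every }v\in\mathbb{R}$$ holds if and only if $\phi$ is the identity function, i.e. $\phi(v)=v$ for every $v\in\mathbb{R}$.
   Context: A Borel version of the inverse regression $y\mapsto\mathbb{E}[V\mid\phi(V)+U=y]$ is a Borel-measurable function $P_\phi\colon\mathbb{R}\to\mathbb{R}$ with $P_\phi(\phi(V)+U)=\mathbb{E}[V\mid\phi(V)+U]$ almost surely. For every such version and every $x\in\mathbb{R}$, $P_\phi(x+U)$ is integrable and $F_\phi(x)$ does not depend on the chosen version. No integrability of $\phi(V)$ is assumed. *)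

theory Defs
  imports "HOL-Probability.Probability"
begin

text \<open>\<open>P\<close> is a Borel version of \<open>y \<mapsto> E[V | \<phi>(V) + U = y]\<close>. Existence of a version and independence of
  the value \<open>F(x) = E[P(x + U)]\<close> from its choice are consequences, not assumptions.\<close>

definition inverse_regression ::
  "'a measure \<Rightarrow> ('a \<Rightarrow> real) \<Rightarrow> ('a \<Rightarrow> real) \<Rightarrow> (real \<Rightarrow> real) \<Rightarrow> (real \<Rightarrow> real) \<Rightarrow> bool" where
  "inverse_regression M V U \<phi> P \<longleftrightarrow>
     P \<in> borel_measurable borel \<and>
     (AE \<omega> in M. P (\<phi> (V \<omega>) + U \<omega>) =
        real_cond_exp M (vimage_algebra (space M) (\<lambda>\<omega>. \<phi> (V \<omega>) + U \<omega>) borel) V \<omega>)"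

definition shifted_expectation :: "'a measure \<Rightarrow> ('a \<Rightarrow> real) \<Rightarrow> (real \<Rightarrow> real) \<Rightarrow> real \<Rightarrow> real" where
  "shifted_expectation M U P x = (\<integral>\<omega>. P (x + U \<omega>) \<partial>M)"

end

theory Submission
  imports Defs
begin

text \<open>
  Write \<open>X = \<phi>(V)\<close>, \<open>Y = X + U\<close>, let \<open>F(x) = E[P(x + U)]\<close>, and let \<open>W(v) = max\<^sub>x x (v - F(x))\<close> be the
  optimal value. The idea is to compute one number, \<open>p = E[U P(Y)]\<close>, in three ways.

  First, \<open>p \<le> 1/2\<close> for every \<open>\<phi>\<close>, optimal or not. With \<open>S = E[U | Y]\<close> and \<open>J = E[S\<^sup>2] = E[S U]\<close> one has
  \<open>E[S V] = E[S P(Y)] = p\<close>, and Bessel's inequality for \<open>S\<close> against the orthonormal pair \<open>U, V\<close> reads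
  \<open>J\<^sup>2 + p\<^sup>2 \<le> J\<close> (\<open>expectation_UP_le_half\<close>).

  Secondly, \<open>p\<close> is both \<open>E[F'(X)]\<close> and \<open>E[W(V)]\<close>. The former is Gaussian integration by parts in \<open>U\<close>
  (\<open>slope_expectation\<close>). For the latter, \<open>E[Y (V - P(Y))] = 0\<close> gives
  \<open>E[X (V - P(Y))] = - E[U (V - P(Y))] = p\<close>; as \<open>X\<close> need not be integrable, \<open>Y\<close> is clipped first and the
  clipping is removed using \<open>W \<ge> 0\<close> (\<open>value_expectation\<close>).

  Thirdly, optimality forces \<open>E[W(V)] + E[F'(X)] \<ge> 1\<close>. The function \<open>W\<close> is convex with subgradient \<open>\<phi>\<close>, and
  the first order condition \<open>v = F(\<phi>(v)) + \<phi>(v) F'(\<phi>(v))\<close> turns into \<open>W = \<phi>\<^sup>2 F'(\<phi>)\<close>. For the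
  increasing function \<open>r = sgn(\<phi>) sqrt(2 W)\<close> this says \<open>F'(\<phi>) = 1 / (2 r'\<^sup>2)\<close>, while \<open>W = r\<^sup>2 / 2\<close>. The
  tangent line bound \<open>1 / (2 r'\<^sup>2) \<ge> 3/2 - r'\<close> and Stein's inequality \<open>E[r'(V)] \<le> E[V r(V)]\<close> then yield
  \<open>E[W(V)] + E[F'(X)] \<ge> 1 + E[(r(V) - V)\<^sup>2] / 2\<close> (\<open>value_plus_slope_ge\<close>).

  Altogether \<open>1 \<ge> 2 p \<ge> 1 + E[(r(V) - V)\<^sup>2] / 2\<close>, so \<open>r\<close> is the identity, \<open>W(v) = v\<^sup>2 / 2\<close>, and the only
  subgradient of that function at \<open>v\<close> is \<open>v\<close>. Conversely, if \<open>\<phi>\<close> is the identity then exchanging \<open>V\<close> and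
  \<open>U\<close> shows \<open>P(Y) = Y / 2\<close>, so that \<open>F(x) = x / 2\<close>.
\<close>

section \<open>The standard normal law on the line\<close>

definition gauss :: "real measure" where
  "gauss = density lborel (\<lambda>x. ennreal (std_normal_density x))"

lemma sets_gauss [simp, measurable_cong]: "sets gauss = sets borel"
  by (simp add: gauss_def)

lemma space_gauss [simp]: "space gauss = UNIV"
  by (simp add: gauss_def)

lemma prob_space_gauss: "prob_space gauss"
  unfolding gauss_def using prob_space_normal_density[of 1 0] by simp

lemma integrable_gauss_iff:
  assumes "f \<in> borel_measurable borel"
  shows "integrable gauss f \<longleftrightarrow> integrable lborel (\<lambda>x. std_normal_density x * f x :: real)"
  using assms unfolding gauss_def by (subst integrable_real_density) auto

lemma integral_gauss:
  assumes "f \<in> borel_measurable borel"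
  shows "integral\<^sup>L gauss f = (\<integral>x. std_normal_density x * f x \<partial>lborel :: real)"
  using assms unfolding gauss_def by (subst integral_real_density) auto

lemma AE_gauss_iff: "(AE x in gauss. Q x) \<longleftrightarrow> (AE x in lborel. Q x)"
  unfolding gauss_def by (subst AE_density) (auto simp: normal_density_pos)

text \<open>
  All translates of the normal law have the Lebesgue null sets, so a property that holds almost surely
  around one centre does so around every other centre.
\<close>

lemma AE_gauss_shift:
  assumes "Measurable.pred borel Q" and "AE u in gauss. Q (x + u)"
  shows "AE u in gauss. Q (y + u)"
proof -
  have [measurable]: "Measurable.pred borel Q" by fact
  have "AE u in lborel. Q (x + ((y - x) + 1 * u))"
    using assms(2) unfolding AE_gauss_iff
    by (intro AE_borel_affine[where P="\<lambda>u. Q (x + u)"]) auto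
  then show ?thesis by (simp add: AE_gauss_iff)
qed

lemma AE_lborel_dense:
  fixes a b :: real
  assumes "AE x in lborel. Q x" and "a < b"
  obtains x where "a < x" "x < b" "Q x"
proof (rule ccontr)
  assume "\<not> thesis"
  then have "\<And>x. Q x \<Longrightarrow> x \<notin> {a<..<b}" using that by auto
  with assms(1) have "AE x in lborel. x \<notin> {a<..<b}" by (auto elim: eventually_mono)
  then have "emeasure lborel {a<..<b} = 0" by (subst (asm) AE_iff_measurable[of "{a<..<b}"]) auto
  then show False using \<open>a < b\<close> by simp
qed

lemma gauss_moments:
  shows "integrable gauss (\<lambda>x. x)" "(\<integral>x. x \<partial>gauss) = 0"
    and "integrable gauss (\<lambda>x. x\<^sup>2)" "(\<integral>x. x\<^sup>2 \<partial>gauss) = 1"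
  using std_normal_moment_odd[of 0] std_normal_moment_even[of 1]
  by (auto simp: integrable_gauss_iff integral_gauss has_bochner_integral_iff)

lemma std_normal_density_shift:
  "std_normal_density (u - d) = std_normal_density u * exp (d * u - d\<^sup>2 / 2)"
  by (simp add: std_normal_density_def exp_add[symmetric] power2_eq_square field_simps)

lemma integrable_gauss_exp: "integrable gauss (\<lambda>u. exp (c * u))"
proof -
  have "integrable lborel (\<lambda>u. exp (c\<^sup>2 / 2) * std_normal_density ((-c) + 1 * u))"
    by (intro integrable_mult_right lborel_integrable_real_affine) auto
  also have "(\<lambda>u. exp (c\<^sup>2 / 2) * std_normal_density ((-c) + 1 * u)) =
      (\<lambda>u. std_normal_density u * exp (c * u))"
    using std_normal_density_shift[of _ c] by (auto simp: exp_diff)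
  finally show ?thesis by (subst integrable_gauss_iff) auto
qed

lemma integrable_gauss_exp_abs: "integrable gauss (\<lambda>u. exp (c * \<bar>u\<bar>))"
proof (rule Bochner_Integration.integrable_bound[of _ "\<lambda>u. exp (c * u) + exp ((-c) * u)"])
  show "integrable gauss (\<lambda>u. exp (c * u) + exp ((-c) * u))"
    by (intro Bochner_Integration.integrable_add integrable_gauss_exp)
  have "exp (c * \<bar>u\<bar>) \<le> exp (c * u) + exp ((-c) * u)" for u :: real
    by (cases "u \<ge> 0") auto
  then show "AE u in gauss. norm (exp (c * \<bar>u\<bar>)) \<le> norm (exp (c * u) + exp ((-c) * u))"
    by (intro AE_I2) (auto intro: order_trans)
qed auto

lemma integrable_mult_of_squares:
  fixes f g :: "'a \<Rightarrow> real"
  assumes [measurable]: "f \<in> borel_measurable M" "g \<in> borel_measurable M"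
    and "integrable M (\<lambda>x. (f x)\<^sup>2)" "integrable M (\<lambda>x. (g x)\<^sup>2)"
  shows "integrable M (\<lambda>x. f x * g x)"
proof (rule Bochner_Integration.integrable_bound[of _ "\<lambda>x. (f x)\<^sup>2 + (g x)\<^sup>2"])
  show "AE x in M. norm (f x * g x) \<le> norm ((f x)\<^sup>2 + (g x)\<^sup>2)"
  proof (rule AE_I2)
    fix x
    have "2 * \<bar>f x * g x\<bar> \<le> (f x)\<^sup>2 + (g x)\<^sup>2"
      using sum_squares_bound[of "\<bar>f x\<bar>" "\<bar>g x\<bar>"] by (simp add: abs_mult)
    then show "norm (f x * g x) \<le> norm ((f x)\<^sup>2 + (g x)\<^sup>2)" by simp
  qed
qed (use assms in auto)

text \<open>
  The Cameron-Martin formula: a translation of the argument is traded for an exponential tilt of the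
  weight, so that regularity of \<open>d \<mapsto> E[f(d + U)]\<close> needs no regularity of \<open>f\<close>.
\<close>

lemma gauss_shift:
  assumes [measurable]: "f \<in> borel_measurable borel"
  shows "integrable gauss (\<lambda>u. f (d + u)) \<longleftrightarrow> integrable gauss (\<lambda>u. f u * exp (d * u - d\<^sup>2 / 2))"
    and "(\<integral>u. f (d + u) \<partial>gauss) = (\<integral>u. f u * exp (d * u - d\<^sup>2 / 2) \<partial>gauss)"
proof -
  let ?g = "\<lambda>u. std_normal_density u * (f u * exp (d * u - d\<^sup>2 / 2))"
  have g: "?g (d + 1 * u) = std_normal_density u * f (d + u)" for u
    using std_normal_density_shift[of "d + u" d] by (simp add: ac_simps)
  have "integrable lborel (\<lambda>u. ?g (d + 1 * u)) \<longleftrightarrow> integrable lborel ?g"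
    by (rule lborel_integrable_real_affine_iff) simp
  then show "integrable gauss (\<lambda>u. f (d + u)) \<longleftrightarrow> integrable gauss (\<lambda>u. f u * exp (d * u - d\<^sup>2 / 2))"
    unfolding g by (simp add: integrable_gauss_iff)
  have "integral\<^sup>L lborel ?g = \<bar>1\<bar> *\<^sub>R (\<integral>u. ?g (d + 1 * u) \<partial>lborel)"
    by (rule lborel_integral_real_affine) simp
  then show "(\<integral>u. f (d + u) \<partial>gauss) = (\<integral>u. f u * exp (d * u - d\<^sup>2 / 2) \<partial>gauss)"
    unfolding g by (simp add: integral_gauss)
qed

section \<open>Gaussian smoothing of a Borel function\<close>

text \<open>
  The tilt is \<open>1 + d u + O(d\<^sup>2)\<close>, with a remainder dominated by an exponential in \<open>u\<close> that does not depend on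
  \<open>d\<close>; this is what differentiates \<open>x \<mapsto> E[P(x + U)]\<close>.
\<close>

lemma exp_tilt_remainder:
  fixes d u :: real
  assumes "\<bar>d\<bar> \<le> 1"
  shows "\<bar>exp (d * u - d\<^sup>2 / 2) - 1 - d * u\<bar> \<le> d\<^sup>2 * (4 * exp (3 * \<bar>u\<bar>))"
proof -
  define s where "s = d * u - d\<^sup>2 / 2"
  have t: "\<bar>exp s - 1 - s\<bar> \<le> s\<^sup>2 * exp \<bar>s\<bar> / 2"
  proof -
    obtain t where t: "\<bar>t\<bar> \<le> \<bar>s\<bar>" "exp s = (\<Sum>m<2. s ^ m / fact m) + exp t / fact 2 * s ^ 2"
      using Maclaurin_exp_le[of s 2] by blast
    then have "\<bar>exp s - 1 - s\<bar> = s\<^sup>2 * exp t / 2"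
      by (simp add: numeral_2_eq_2 abs_mult)
    also have "\<dots> \<le> s\<^sup>2 * exp \<bar>s\<bar> / 2"
      using t(1) by (intro divide_right_mono mult_left_mono) auto
    finally show ?thesis .
  qed
  have "\<bar>d\<bar> * \<bar>d\<bar> \<le> \<bar>d\<bar> * 1" using assms by (intro mult_left_mono) auto
  then have d2: "d\<^sup>2 \<le> \<bar>d\<bar>" by (simp add: power2_eq_square)
  have "\<bar>s\<bar> \<le> \<bar>d * u\<bar> + \<bar>d\<^sup>2 / 2\<bar>" unfolding s_def by (rule abs_triangle_ineq4)
  also have "\<dots> \<le> \<bar>d\<bar> * (\<bar>u\<bar> + 1)" using d2 unfolding abs_mult distrib_left by simp
  finally have s1: "\<bar>s\<bar> \<le> \<bar>d\<bar> * (\<bar>u\<bar> + 1)" .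
  also have "\<dots> \<le> 1 * (\<bar>u\<bar> + 1)" using assms by (intro mult_right_mono) auto
  finally have s2: "\<bar>s\<bar> \<le> \<bar>u\<bar> + 1" by simp
  have "s\<^sup>2 \<le> (\<bar>d\<bar> * (\<bar>u\<bar> + 1))\<^sup>2" using s1 by (metis abs_ge_zero power2_abs power_mono)
  also have "\<dots> = d\<^sup>2 * (\<bar>u\<bar> + 1)\<^sup>2" by (simp add: power_mult_distrib)
  also have "\<dots> \<le> d\<^sup>2 * (exp \<bar>u\<bar>)\<^sup>2"
    by (intro mult_left_mono power_mono) (auto simp: add.commute exp_ge_add_one_self)
  finally have s3: "s\<^sup>2 \<le> d\<^sup>2 * (exp \<bar>u\<bar>)\<^sup>2" .
  have "s\<^sup>2 * exp \<bar>s\<bar> \<le> (d\<^sup>2 * (exp \<bar>u\<bar>)\<^sup>2) * exp (\<bar>u\<bar> + 1)"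
    using s2 s3 by (intro mult_mono) auto
  also have "\<dots> = d\<^sup>2 * (exp 1 * exp (3 * \<bar>u\<bar>))"
    by (simp add: power2_eq_square flip: exp_add)
  also have "\<dots> \<le> d\<^sup>2 * (3 * exp (3 * \<bar>u\<bar>))"
    using exp_le by (intro mult_left_mono mult_right_mono) auto
  finally have a: "s\<^sup>2 * exp \<bar>s\<bar> \<le> d\<^sup>2 * (3 * exp (3 * \<bar>u\<bar>))" .
  have "d\<^sup>2 * 1 \<le> d\<^sup>2 * exp (3 * \<bar>u\<bar>)" by (intro mult_left_mono) auto
  moreover have "\<bar>exp s - 1 - d * u\<bar> \<le> \<bar>exp s - 1 - s\<bar> + d\<^sup>2 / 2"
    unfolding s_def using zero_le_power2[of d] by linarith
  ultimately have "\<bar>exp s - 1 - d * u\<bar> \<le> d\<^sup>2 * (4 * exp (3 * \<bar>u\<bar>))"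
    using t a by (simp add: algebra_simps)
  then show ?thesis by (simp add: s_def)
qed

definition gauss_mean :: "(real \<Rightarrow> real) \<Rightarrow> real \<Rightarrow> real" where
  "gauss_mean P x = (\<integral>u. P (x + u) \<partial>gauss)"

text \<open>
  This is the derivative of \<open>gauss_mean P\<close>, in the form in which \<open>P\<close> is not differentiated.
\<close>

definition gauss_slope :: "(real \<Rightarrow> real) \<Rightarrow> real \<Rightarrow> real" where
  "gauss_slope P x = (\<integral>u. u * P (x + u) \<partial>gauss)"

text \<open>
  Exponential integrability around a single centre spreads to all centres, because the tilt that moves
  the centre is itself of exponential size.
\<close>

lemma exp_integrable_shift:
  assumes [measurable]: "P \<in> borel_measurable borel"
    and x0: "\<And>c. integrable gauss (\<lambda>u. P (x0 + u) * exp (c * \<bar>u\<bar>))"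
  shows "integrable gauss (\<lambda>u. P (x + u) * exp (c * \<bar>u\<bar>))"
proof -
  define d where "d = x - x0"
  let ?f = "\<lambda>u. P (x0 + u) * exp (c * \<bar>u - d\<bar>)"
  have "integrable gauss (\<lambda>u. ?f u * exp (d * u - d\<^sup>2 / 2))"
  proof (rule Bochner_Integration.integrable_bound)
    show "integrable gauss (\<lambda>u. exp (\<bar>c\<bar> * \<bar>d\<bar>) * (P (x0 + u) * exp ((\<bar>c\<bar> + \<bar>d\<bar>) * \<bar>u\<bar>)))"
      using x0 by (intro integrable_mult_right)
    show "AE u in gauss. norm (?f u * exp (d * u - d\<^sup>2 / 2)) \<le>
        norm (exp (\<bar>c\<bar> * \<bar>d\<bar>) * (P (x0 + u) * exp ((\<bar>c\<bar> + \<bar>d\<bar>) * \<bar>u\<bar>)))"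
    proof (rule AE_I2)
      fix u
      have "c * \<bar>u - d\<bar> \<le> \<bar>c\<bar> * (\<bar>u\<bar> + \<bar>d\<bar>)" by (intro mult_mono) auto
      moreover have "d * u \<le> \<bar>d\<bar> * \<bar>u\<bar>" by (simp flip: abs_mult)
      ultimately have "c * \<bar>u - d\<bar> + (d * u - d\<^sup>2 / 2) \<le> \<bar>c\<bar> * \<bar>d\<bar> + (\<bar>c\<bar> + \<bar>d\<bar>) * \<bar>u\<bar>"
        using zero_le_power2[of d] unfolding distrib_left distrib_right by linarith
      then have "exp (c * \<bar>u - d\<bar>) * exp (d * u - d\<^sup>2 / 2) \<le> exp (\<bar>c\<bar> * \<bar>d\<bar>) * exp ((\<bar>c\<bar> + \<bar>d\<bar>) * \<bar>u\<bar>)"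
        by (simp flip: exp_add)
      then have "\<bar>P (x0 + u)\<bar> * (exp (c * \<bar>u - d\<bar>) * exp (d * u - d\<^sup>2 / 2)) \<le>
          \<bar>P (x0 + u)\<bar> * (exp (\<bar>c\<bar> * \<bar>d\<bar>) * exp ((\<bar>c\<bar> + \<bar>d\<bar>) * \<bar>u\<bar>))"
        by (intro mult_left_mono) auto
      then show "norm (?f u * exp (d * u - d\<^sup>2 / 2)) \<le>
        norm (exp (\<bar>c\<bar> * \<bar>d\<bar>) * (P (x0 + u) * exp ((\<bar>c\<bar> + \<bar>d\<bar>) * \<bar>u\<bar>)))"
        by (simp add: abs_mult ac_simps)
    qed
  qed auto
  then have "integrable gauss (\<lambda>u. ?f (d + u))"
    by (subst gauss_shift) auto
  then show ?thesis by (simp add: d_def)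
qed

lemma gauss_mean_deriv:
  assumes [measurable]: "P \<in> borel_measurable borel"
    and int: "\<And>c. integrable gauss (\<lambda>u. P (x + u) * exp (c * \<bar>u\<bar>))"
  shows "(gauss_mean P has_real_derivative gauss_slope P x) (at x)"
proof -
  let ?C = "\<integral>u. \<bar>P (x + u) * (4 * exp (3 * \<bar>u\<bar>))\<bar> \<partial>gauss"
  have i0: "integrable gauss (\<lambda>u. P (x + u))" using int[of 0] by simp
  have i1: "integrable gauss (\<lambda>u. u * P (x + u))"
  proof (rule Bochner_Integration.integrable_bound[OF int[of 1]], simp, rule AE_I2)
    fix u :: real
    have "\<bar>u\<bar> \<le> exp (1 * \<bar>u\<bar>)" using exp_ge_add_one_self[of "\<bar>u\<bar>"] unfolding mult_1 by linarith
    then show "norm (u * P (x + u)) \<le> norm (P (x + u) * exp (1 * \<bar>u\<bar>))"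
      using mult_left_mono[of "\<bar>u\<bar>" "exp (1 * \<bar>u\<bar>)" "\<bar>P (x + u)\<bar>"] by (simp add: abs_mult ac_simps)
  qed
  have i3: "integrable gauss (\<lambda>u. P (x + u) * (4 * exp (3 * \<bar>u\<bar>)))"
    using integrable_mult_right[OF int[of 3], of 4] by (simp add: ac_simps)
  have id: "integrable gauss (\<lambda>u. P (x + u) * exp (d * u - d\<^sup>2 / 2))" for d
  proof (rule Bochner_Integration.integrable_bound[OF int[of "\<bar>d\<bar>"]], simp, rule AE_I2)
    fix u :: real
    have "d * u \<le> \<bar>d\<bar> * \<bar>u\<bar>" by (simp flip: abs_mult)
    then have "d * u - d\<^sup>2 / 2 \<le> \<bar>d\<bar> * \<bar>u\<bar>" using zero_le_power2[of d] by linarith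
    then show "norm (P (x + u) * exp (d * u - d\<^sup>2 / 2)) \<le> norm (P (x + u) * exp (\<bar>d\<bar> * \<bar>u\<bar>))"
      by (simp add: abs_mult mult_left_mono)
  qed
  have bound: "\<bar>gauss_mean P (x + d) - gauss_mean P x - d * gauss_slope P x\<bar> \<le> d\<^sup>2 * ?C" if d: "\<bar>d\<bar> \<le> 1" for d
  proof -
    have "gauss_mean P (x + d) = (\<integral>u. P (x + u) * exp (d * u - d\<^sup>2 / 2) \<partial>gauss)"
      unfolding gauss_mean_def using gauss_shift(2)[of "\<lambda>u. P (x + u)" d] by (simp add: add.assoc)
    moreover have eq: "P (x + u) * (d * u) = d * (u * P (x + u))" for u by simp
    ultimately have "gauss_mean P (x + d) - gauss_mean P x - d * gauss_slope P x =
        (\<integral>u. P (x + u) * (exp (d * u - d\<^sup>2 / 2) - 1 - d * u) \<partial>gauss)"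
      unfolding gauss_mean_def gauss_slope_def right_diff_distrib mult_1_right eq
      using id[of d] i0 i1 by simp
    also have "\<bar>\<dots>\<bar> \<le> (\<integral>u. d\<^sup>2 * \<bar>P (x + u) * (4 * exp (3 * \<bar>u\<bar>))\<bar> \<partial>gauss)"
    proof (rule integral_abs_bound[THEN order_trans], rule integral_mono)
      show "integrable gauss (\<lambda>u. \<bar>P (x + u) * (exp (d * u - d\<^sup>2 / 2) - 1 - d * u)\<bar>)"
        using id[of d] i0 integrable_mult_right[OF i1, of d]
        by (intro integrable_abs) (simp add: algebra_simps)
      fix u
      have "\<bar>P (x + u)\<bar> * \<bar>exp (d * u - d\<^sup>2 / 2) - 1 - d * u\<bar> \<le> \<bar>P (x + u)\<bar> * (d\<^sup>2 * (4 * exp (3 * \<bar>u\<bar>)))"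
        by (intro mult_left_mono exp_tilt_remainder d) auto
      then show "\<bar>P (x + u) * (exp (d * u - d\<^sup>2 / 2) - 1 - d * u)\<bar> \<le> d\<^sup>2 * \<bar>P (x + u) * (4 * exp (3 * \<bar>u\<bar>))\<bar>"
        by (simp add: abs_mult ac_simps)
    qed (use i3 in auto)
    finally show ?thesis by simp
  qed
  have "((\<lambda>d. (gauss_mean P (x + d) - gauss_mean P x) / d) \<longlongrightarrow> gauss_slope P x) (at 0)"
  proof (rule LIM_zero_cancel, rule Lim_null_comparison)
    show "\<forall>\<^sub>F d in at 0. norm ((gauss_mean P (x + d) - gauss_mean P x) / d - gauss_slope P x) \<le> \<bar>d\<bar> * ?C"
      unfolding eventually_at
    proof (intro exI[of _ 1] conjI ballI impI)
      fix d :: real assume d: "d \<noteq> 0 \<and> dist d 0 < 1"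
      have "norm ((gauss_mean P (x + d) - gauss_mean P x) / d - gauss_slope P x) =
         \<bar>gauss_mean P (x + d) - gauss_mean P x - d * gauss_slope P x\<bar> / \<bar>d\<bar>"
        using d by (simp add: field_simps flip: abs_divide)
      also have "\<dots> \<le> d\<^sup>2 * ?C / \<bar>d\<bar>" using d by (intro divide_right_mono bound) auto
      also have "\<dots> = \<bar>d\<bar> * ?C" using d by (simp add: field_simps power2_eq_square abs_if)
      finally show "norm ((gauss_mean P (x + d) - gauss_mean P x) / d - gauss_slope P x) \<le> \<bar>d\<bar> * ?C" .
    qed simp
    show "((\<lambda>d. \<bar>d\<bar> * ?C) \<longlongrightarrow> 0) (at 0)" by (auto intro!: tendsto_eq_intros)
  qed
  then show ?thesis by (simp add: DERIV_def)
qed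

section \<open>Stein's inequality for increasing functions\<close>

text \<open>
  Stein's identity is \<open>E[f'(V)] = E[V f(V)]\<close> for absolutely continuous \<open>f\<close>. An increasing \<open>f\<close> may have jumps,
  which only add to the right-hand side. The right-hand side is the derivative at \<open>0\<close> of
  \<open>d \<mapsto> E[f(V + d)]\<close>, and Fatou's lemma for the nonnegative difference quotients gives the inequality.
\<close>

lemma stein_inequality_mono:
  fixes f f' :: "real \<Rightarrow> real"
  assumes mono: "mono f"
    and sq: "integrable gauss (\<lambda>v. (f v)\<^sup>2)"
    and [measurable]: "f' \<in> borel_measurable borel"
    and deriv: "AE v in gauss. 0 \<le> f' v \<and> (f has_real_derivative f' v) (at v)"
  shows "integrable gauss f'" and "(\<integral>v. f' v \<partial>gauss) \<le> (\<integral>v. v * f v \<partial>gauss)"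
proof -
  have [measurable]: "f \<in> borel_measurable borel" using mono by (rule borel_measurable_mono)
  have ex: "integrable gauss (\<lambda>u. f (0 + u) * exp (c * \<bar>u\<bar>))" for c
  proof (rule integrable_mult_of_squares)
    have "(\<lambda>u. (exp (c * \<bar>u\<bar>))\<^sup>2) = (\<lambda>u. exp ((2 * c) * \<bar>u\<bar>))"
      by (simp add: power2_eq_square mult.assoc flip: exp_add)
    then show "integrable gauss (\<lambda>u. (exp (c * \<bar>u\<bar>))\<^sup>2)"
      using integrable_gauss_exp_abs[of "2 * c"] by simp
  qed (use sq in auto)
  have shiftint: "integrable gauss (\<lambda>u. f (x + u))" for x
    using exp_integrable_shift[OF _ ex, of x 0] by simp
  have D: "((\<lambda>h. (gauss_mean f (0 + h) - gauss_mean f 0) / h) \<longlongrightarrow> gauss_slope f 0) (at 0)"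
    using gauss_mean_deriv[OF _ ex] by (simp add: DERIV_def)
  define h where "h n = 1 / real (Suc n)" for n
  have h0: "h \<longlonglongrightarrow> 0" unfolding h_def by (rule LIMSEQ_Suc[OF lim_1_over_n])
  have hpos: "h n > 0" for n by (simp add: h_def)
  have hat: "filterlim h (at 0) sequentially"
    using h0 hpos by (auto simp: filterlim_at less_imp_neq[symmetric])
  let ?q = "\<lambda>n v. (f (v + h n) - f v) / h n"
  have q0: "0 \<le> ?q n v" for n v
    using monoD[OF mono, of v "v + h n"] hpos[of n] by (intro divide_nonneg_pos) auto
  have qint: "integrable gauss (?q n)" for n
    using shiftint[of "h n"] shiftint[of 0] by (simp add: add.commute)
  have qeq: "integral\<^sup>L gauss (?q n) = (gauss_mean f (0 + h n) - gauss_mean f 0) / h n" for n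
    using shiftint[of "h n"] shiftint[of 0] by (simp add: gauss_mean_def add.commute)
  have lim: "(\<lambda>n. integral\<^sup>L gauss (?q n)) \<longlonglongrightarrow> (\<integral>v. v * f v \<partial>gauss)"
    unfolding qeq using filterlim_compose[OF D hat] by (simp add: gauss_slope_def)
  have nnlim: "(\<lambda>n. \<integral>\<^sup>+v. ennreal (?q n v) \<partial>gauss) \<longlonglongrightarrow> ennreal (\<integral>v. v * f v \<partial>gauss)"
    using lim by (subst nn_integral_eq_integral[OF qint]) (auto simp: q0)
  have "(\<integral>\<^sup>+v. ennreal (f' v) \<partial>gauss) = (\<integral>\<^sup>+v. liminf (\<lambda>n. ennreal (?q n v)) \<partial>gauss)"
  proof (rule nn_integral_cong_AE, use deriv in eventually_elim)
    case (elim v)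
    then have "((\<lambda>h. (f (v + h) - f v) / h) \<longlongrightarrow> f' v) (at 0)" by (simp add: DERIV_def)
    from filterlim_compose[OF this hat]
    have "(\<lambda>n. ennreal (?q n v)) \<longlonglongrightarrow> ennreal (f' v)" by (intro tendsto_intros) simp
    then show ?case by (simp add: lim_imp_Liminf)
  qed
  also have "\<dots> \<le> liminf (\<lambda>n. \<integral>\<^sup>+v. ennreal (?q n v) \<partial>gauss)"
    by (rule nn_integral_liminf) simp
  also have "\<dots> = ennreal (\<integral>v. v * f v \<partial>gauss)"
    using nnlim by (simp add: lim_imp_Liminf)
  finally have le: "(\<integral>\<^sup>+v. ennreal (f' v) \<partial>gauss) \<le> ennreal (\<integral>v. v * f v \<partial>gauss)" .
  have "AE v in gauss. 0 \<le> f' v" using deriv by eventually_elim simp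
  then show int: "integrable gauss f'"
    using le by (intro integrableI_nonneg) (auto intro: le_less_trans)
  have nn: "0 \<le> (\<integral>v. v * f v \<partial>gauss)"
    by (rule LIMSEQ_le_const[OF lim]) (use q0 in \<open>blast intro: Bochner_Integration.integral_nonneg\<close>)
  show "(\<integral>v. f' v \<partial>gauss) \<le> (\<integral>v. v * f v \<partial>gauss)"
    using le nn \<open>AE v in gauss. 0 \<le> f' v\<close>
    by (subst (asm) nn_integral_eq_integral[OF int]) (auto simp: ennreal_le_iff)
qed

section \<open>Subgradients and the signed root of a convex function\<close>

lemma subgradient_imp_mono:
  fixes W \<phi> :: "real \<Rightarrow> real"
  assumes sub: "\<And>u v. W u + \<phi> u * (v - u) \<le> W v"
  shows "mono \<phi>"
proof (rule monoI, rule ccontr)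
  fix u v :: real assume "u \<le> v" "\<not> \<phi> u \<le> \<phi> v"
  then have "0 < (\<phi> u - \<phi> v) * (v - u)" by (cases "u = v") auto
  then show False using sub[of u v] sub[of v u] by (simp add: algebra_simps)
qed

lemma subgradient_imp_deriv:
  fixes W \<phi> :: "real \<Rightarrow> real"
  assumes sub: "\<And>u v. W u + \<phi> u * (v - u) \<le> W v" and cont: "isCont \<phi> v"
  shows "(W has_real_derivative \<phi> v) (at v)"
proof -
  have "((\<lambda>y. (W y - W v) / (y - v) - \<phi> v) \<longlongrightarrow> 0) (at v)"
  proof (rule Lim_null_comparison)
    show "\<forall>\<^sub>F y in at v. norm ((W y - W v) / (y - v) - \<phi> v) \<le> \<bar>\<phi> y - \<phi> v\<bar>"
      unfolding eventually_at
    proof (intro exI[of _ 1] conjI ballI impI)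
      fix y assume "y \<noteq> v \<and> dist y v < 1"
      then have y: "y \<noteq> v" by simp
      have a: "0 \<le> W y - W v - \<phi> v * (y - v)" using sub[of v y] by simp
      have b: "W y - W v - \<phi> v * (y - v) \<le> (\<phi> y - \<phi> v) * (y - v)"
        using sub[of y v] by (simp add: algebra_simps)
      have "norm ((W y - W v) / (y - v) - \<phi> v) = \<bar>W y - W v - \<phi> v * (y - v)\<bar> / \<bar>y - v\<bar>"
        using y by (simp add: diff_divide_distrib flip: abs_divide)
      also have "\<dots> \<le> \<bar>(\<phi> y - \<phi> v) * (y - v)\<bar> / \<bar>y - v\<bar>"
        using a b by (intro divide_right_mono) auto
      also have "\<dots> = \<bar>\<phi> y - \<phi> v\<bar>" using y by (simp add: abs_mult)
      finally show "norm ((W y - W v) / (y - v) - \<phi> v) \<le> \<bar>\<phi> y - \<phi> v\<bar>" .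
    qed simp
    show "((\<lambda>y. \<bar>\<phi> y - \<phi> v\<bar>) \<longlongrightarrow> 0) (at v)"
      using cont unfolding isCont_def by (auto intro!: tendsto_eq_intros)
  qed
  then show ?thesis unfolding has_field_derivative_iff by (rule LIM_zero_cancel)
qed

text \<open>
  For \<open>W(v) = v\<^sup>2 / 2\<close> and \<open>\<phi>(v) = v\<close> this is the identity. The sign makes it increasing across the minimum
  of \<open>W\<close>, where it jumps upwards if that minimum is positive.
\<close>

definition signed_root :: "(real \<Rightarrow> real) \<Rightarrow> (real \<Rightarrow> real) \<Rightarrow> real \<Rightarrow> real" where
  "signed_root W \<phi> v = sgn (\<phi> v) * sqrt (2 * W v)"

lemma signed_root_mono:
  fixes W \<phi> :: "real \<Rightarrow> real"
  assumes sub: "\<And>u v. W u + \<phi> u * (v - u) \<le> W v" and W0: "\<And>v. 0 \<le> W v"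
  shows "mono (signed_root W \<phi>)"
proof (rule monoI)
  fix u v :: real assume uv: "u \<le> v"
  note m = monoD[OF subgradient_imp_mono[OF sub] uv]
  consider "0 < \<phi> u" | "\<phi> v < 0" | "\<phi> u \<le> 0" "0 \<le> \<phi> v" by linarith
  then show "signed_root W \<phi> u \<le> signed_root W \<phi> v"
  proof cases
    case 1
    then have "0 \<le> \<phi> u * (v - u)" using uv by simp
    then have "W u \<le> W v" using sub[of u v] by linarith
    then show ?thesis using 1 m by (simp add: signed_root_def)
  next
    case 2
    then have "0 \<le> \<phi> v * (u - v)" using uv by (simp add: mult_nonpos_nonpos)
    then have "W v \<le> W u" using sub[of v u] by linarith
    then show ?thesis using 2 m by (simp add: signed_root_def)
  next
    case 3
    then have "signed_root W \<phi> u \<le> 0" "0 \<le> signed_root W \<phi> v"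
      using W0 by (auto simp: signed_root_def sgn_if mult_le_0_iff)
    then show ?thesis by simp
  qed
qed

text \<open>
  Away from the countably many discontinuities of \<open>\<phi>\<close> the convex function \<open>W\<close> has derivative \<open>\<phi>\<close>, and the chain
  rule applies as soon as \<open>W\<close> is positive. Positivity holds since \<open>W\<close> is nonnegative and a zero would be a
  minimum, at which the derivative \<open>\<phi>\<close> vanishes.
\<close>

lemma signed_root_deriv:
  fixes W \<phi> :: "real \<Rightarrow> real"
  assumes sub: "\<And>u v. W u + \<phi> u * (v - u) \<le> W v" and W0: "\<And>v. 0 \<le> W v"
    and cont: "isCont \<phi> v" and nz: "\<phi> v \<noteq> 0"
  shows "0 < W v"
    and "(signed_root W \<phi> has_real_derivative \<bar>\<phi> v\<bar> / sqrt (2 * W v)) (at v)"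
proof -
  have D: "(W has_real_derivative \<phi> v) (at v)" by (rule subgradient_imp_deriv[OF sub cont])
  show pos: "0 < W v"
  proof (rule ccontr)
    assume "\<not> 0 < W v"
    then have "\<forall>y. \<bar>v - y\<bar> < 1 \<longrightarrow> W v \<le> W y" using W0 by (meson not_less order_trans)
    from DERIV_local_min[OF D zero_less_one this] show False using nz by simp
  qed
  have "((\<lambda>y. sgn (\<phi> v) * sqrt (2 * W y)) has_real_derivative \<bar>\<phi> v\<bar> / sqrt (2 * W v)) (at v)"
  proof (rule DERIV_cong)
    show "((\<lambda>y. sgn (\<phi> v) * sqrt (2 * W y)) has_real_derivative
        sgn (\<phi> v) * (inverse (sqrt (2 * W v)) / 2 * (2 * \<phi> v))) (at v)"
      using pos by (intro DERIV_cmult DERIV_chain2[OF DERIV_real_sqrt DERIV_cmult[OF D]]) simp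
    show "sgn (\<phi> v) * (inverse (sqrt (2 * W v)) / 2 * (2 * \<phi> v)) = \<bar>\<phi> v\<bar> / sqrt (2 * W v)"
      using nz by (cases "\<phi> v > 0") (simp_all add: inverse_eq_divide)
  qed
  moreover have "\<forall>\<^sub>F y in nhds v. sgn (\<phi> v) * sqrt (2 * W y) = signed_root W \<phi> y"
  proof -
    have "\<forall>\<^sub>F y in at v. dist (\<phi> y) (\<phi> v) < \<bar>\<phi> v\<bar>"
      using cont nz unfolding isCont_def by (intro tendstoD) auto
    then have "\<forall>\<^sub>F y in nhds v. dist (\<phi> y) (\<phi> v) < \<bar>\<phi> v\<bar>"
      unfolding eventually_at_filter by (rule eventually_mono) (use nz in auto)
    then show ?thesis
      by eventually_elim (auto simp: signed_root_def dist_real_def sgn_if abs_if split: if_splits)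
  qed
  ultimately show "(signed_root W \<phi> has_real_derivative \<bar>\<phi> v\<bar> / sqrt (2 * W v)) (at v)"
    by (subst DERIV_cong_ev[OF refl _ refl, symmetric]) auto
qed

text \<open>
  The right-hand side is convex on the positive axis; the left-hand side is its tangent at \<open>w = 1\<close>, the
  slope of the signed root when \<open>\<phi>\<close> is the identity.
\<close>

lemma reciprocal_square_tangent:
  fixes w :: real
  assumes "0 < w"
  shows "3 / 2 - w \<le> 1 / (2 * w\<^sup>2)"
proof -
  have "0 \<le> (w - 1)\<^sup>2 * (2 * w + 1)" using assms by simp
  then have "(3 / 2 - w) * (2 * w\<^sup>2) \<le> 1" by (simp add: power2_eq_square algebra_simps)
  then show ?thesis using assms by (simp add: field_simps)
qed

text \<open>
  With \<open>r\<close> the signed root, \<open>W = r\<^sup>2 / 2 = (r - v)\<^sup>2 / 2 + v r - v\<^sup>2 / 2\<close>, and \<open>W = \<phi>\<^sup>2 k\<close> says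
  \<open>k = 1 / (2 r'\<^sup>2)\<close>, which is at least \<open>3/2 - r'\<close>. After integration the terms \<open>v r\<close> and \<open>r'\<close> compare by
  Stein's inequality, and the constants add up to \<open>3/2 - 1/2 = 1\<close>.
\<close>

lemma value_plus_slope_ge:
  fixes W \<phi> k :: "real \<Rightarrow> real"
  assumes sub: "\<And>u v. W u + \<phi> u * (v - u) \<le> W v" and W0: "\<And>v. 0 \<le> W v"
    and foc: "\<And>v. W v = (\<phi> v)\<^sup>2 * k v"
    and nz: "AE v in gauss. \<phi> v \<noteq> 0"
    and Wint: "integrable gauss W" and kint: "integrable gauss k"
  shows "1 + (\<integral>v. (signed_root W \<phi> v - v)\<^sup>2 \<partial>gauss) / 2 \<le> (\<integral>v. W v + k v \<partial>gauss)"
    and "integrable gauss (\<lambda>v. (signed_root W \<phi> v - v)\<^sup>2)"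
proof -
  interpret prob_space gauss by (rule prob_space_gauss)
  let ?r = "signed_root W \<phi>" and ?w = "\<lambda>v. \<bar>\<phi> v\<bar> / sqrt (2 * W v)"
  have mono: "mono ?r" by (rule signed_root_mono[OF sub W0])
  have m\<phi>: "mono \<phi>" by (rule subgradient_imp_mono[OF sub])
  have [measurable]: "\<phi> \<in> borel_measurable borel" "?r \<in> borel_measurable borel"
    using mono m\<phi> by (auto intro: borel_measurable_mono)
  have [measurable]: "W \<in> borel_measurable borel" "k \<in> borel_measurable borel"
    using Wint kint by (auto dest: borel_measurable_integrable)
  have sq: "AE v in gauss. (?r v)\<^sup>2 = 2 * W v"
    using nz by eventually_elim (simp add: signed_root_def power_mult_distrib W0 sgn_if)
  have rint: "integrable gauss (\<lambda>v. (?r v)\<^sup>2)"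
    using Wint by (subst integrable_cong_AE[OF _ _ sq]) auto
  have vr: "integrable gauss (\<lambda>v. v * ?r v)"
    by (rule integrable_mult_of_squares[OF _ _ gauss_moments(3) rint]) auto
  have "AE v in lborel. isCont \<phi> v"
    by (rule AE_I'[OF countable_imp_null_set_lborel[OF mono_ctble_discont[OF m\<phi>]]]) simp
  then have cont: "AE v in gauss. isCont \<phi> v" by (simp add: AE_gauss_iff)
  have dr: "AE v in gauss. 0 \<le> ?w v \<and> (?r has_real_derivative ?w v) (at v)"
    using cont nz by eventually_elim (auto simp: W0 intro: signed_root_deriv(2)[OF sub W0])
  note stein = stein_inequality_mono[OF mono rint _ dr]
  have wint: "integrable gauss ?w" and wle: "(\<integral>v. ?w v \<partial>gauss) \<le> (\<integral>v. v * ?r v \<partial>gauss)"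
    using stein by auto
  show dint: "integrable gauss (\<lambda>v. (?r v - v)\<^sup>2)"
  proof -
    have "(\<lambda>v. (?r v - v)\<^sup>2) = (\<lambda>v. (?r v)\<^sup>2 + v\<^sup>2 - 2 * (v * ?r v))"
      by (simp add: power2_diff ac_simps)
    then show ?thesis using rint vr gauss_moments(3) by simp
  qed
  have pt: "AE v in gauss. (?r v - v)\<^sup>2 / 2 + v * ?r v - v\<^sup>2 / 2 + (3 / 2 - ?w v) \<le> W v + k v"
    using cont nz sq
  proof eventually_elim
    case (elim v)
    note pos = signed_root_deriv(1)[OF sub W0 elim(1,2)]
    have w: "0 < ?w v" using pos elim by simp
    have "1 / (2 * (?w v)\<^sup>2) = k v"
      using foc[of v] pos elim by (simp add: power_divide field_simps)
    then have "3 / 2 - ?w v \<le> k v" using reciprocal_square_tangent[OF w] by simp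
    moreover have "(?r v - v)\<^sup>2 / 2 + v * ?r v - v\<^sup>2 / 2 = W v"
      using elim(3) by (simp add: power2_diff field_simps)
    ultimately show ?case by simp
  qed
  have i1: "integrable gauss (\<lambda>v. (?r v - v)\<^sup>2 / 2)" using dint by (rule integrable_divide)
  have i2: "integrable gauss (\<lambda>v. v\<^sup>2 / 2)" using gauss_moments(3) by (rule integrable_divide)
  have i3: "integrable gauss (\<lambda>v. 3 / 2 - ?w v)"
    by (rule Bochner_Integration.integrable_diff[OF integrable_const wint])
  note i4 = Bochner_Integration.integrable_add[OF i1 vr]
  note i5 = Bochner_Integration.integrable_diff[OF i4 i2]
  note i6 = Bochner_Integration.integrable_add[OF i5 i3]
  have "(\<integral>v. (?r v - v)\<^sup>2 / 2 + v * ?r v - v\<^sup>2 / 2 + (3 / 2 - ?w v) \<partial>gauss) \<le> (\<integral>v. W v + k v \<partial>gauss)"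
    by (rule integral_mono_AE[OF i6 Bochner_Integration.integrable_add[OF Wint kint] pt])
  moreover have "(\<integral>v. 3 / 2 - ?w v \<partial>gauss) = 3 / 2 - (\<integral>v. ?w v \<partial>gauss)"
    by (subst Bochner_Integration.integral_diff[OF integrable_const wint]) (use prob_space in simp)
  then have "(\<integral>v. (?r v - v)\<^sup>2 / 2 + v * ?r v - v\<^sup>2 / 2 + (3 / 2 - ?w v) \<partial>gauss) =
     (\<integral>v. (?r v - v)\<^sup>2 \<partial>gauss) / 2 + (\<integral>v. v * ?r v \<partial>gauss) - 1 / 2 + (3 / 2 - (\<integral>v. ?w v \<partial>gauss))"
    unfolding Bochner_Integration.integral_add[OF i5 i3] Bochner_Integration.integral_diff[OF i4 i2]
      Bochner_Integration.integral_add[OF i1 vr]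
    by (simp add: gauss_moments(4))
  ultimately show "1 + (\<integral>v. (?r v - v)\<^sup>2 \<partial>gauss) / 2 \<le> (\<integral>v. W v + k v \<partial>gauss)"
    using wle by simp
qed

text \<open>
  In the equality case the signed root is almost everywhere, hence by monotonicity everywhere, the
  identity. Thus \<open>W(v) = v\<^sup>2 / 2\<close>, which is differentiable, and \<open>\<phi>(v)\<close> must be its derivative \<open>v\<close>.
\<close>

lemma identity_if_value_plus_slope_le:
  fixes W \<phi> k :: "real \<Rightarrow> real"
  assumes sub: "\<And>u v. W u + \<phi> u * (v - u) \<le> W v" and W0: "\<And>v. 0 \<le> W v"
    and foc: "\<And>v. W v = (\<phi> v)\<^sup>2 * k v"
    and nz: "AE v in gauss. \<phi> v \<noteq> 0"
    and Wint: "integrable gauss W" and kint: "integrable gauss k"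
    and le: "(\<integral>v. W v + k v \<partial>gauss) \<le> 1"
  shows "\<phi> v = v"
proof -
  let ?r = "signed_root W \<phi>"
  note ge = value_plus_slope_ge[OF sub W0 foc nz Wint kint]
  have "(\<integral>v. (?r v - v)\<^sup>2 \<partial>gauss) = 0"
  proof (rule antisym)
    show "(\<integral>v. (?r v - v)\<^sup>2 \<partial>gauss) \<le> 0" using ge(1) le by linarith
  qed (rule Bochner_Integration.integral_nonneg, simp)
  then have "AE v in gauss. (?r v - v)\<^sup>2 = 0"
    using integral_nonneg_eq_0_iff_AE[OF ge(2)] by simp
  then have ae: "AE v in lborel. ?r v = v" by (simp add: AE_gauss_iff)
  have mono: "mono ?r" by (rule signed_root_mono[OF sub W0])
  have r: "?r v = v" for v
  proof (rule antisym)
    show "?r v \<le> v"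
    proof (rule dense_ge)
      fix b assume "v < b"
      then obtain x where "v < x" "x < b" "?r x = x" using AE_lborel_dense[OF ae] by blast
      then show "?r v \<le> b" using monoD[OF mono, of v x] by linarith
    qed
    show "v \<le> ?r v"
    proof (rule dense_le)
      fix b assume "b < v"
      then obtain x where "b < x" "x < v" "?r x = x" using AE_lborel_dense[OF ae] by blast
      then show "b \<le> ?r v" using monoD[OF mono, of x v] by linarith
    qed
  qed
  have W: "W v = v\<^sup>2 / 2" for v
  proof (cases "\<phi> v = 0")
    case True
    then have "v = 0" using r[of v] by (simp add: signed_root_def)
    then show ?thesis using foc[of v] True by simp
  next
    case False
    then have "(?r v)\<^sup>2 = 2 * W v" by (simp add: signed_root_def power_mult_distrib W0 sgn_if)
    then show ?thesis by (simp add: r)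
  qed
  \<comment> \<open>The subgradient inequality at \<open>v\<close>, tested at the point \<open>\<phi> v\<close>, completes the square.\<close>
  have "(\<phi> v - v)\<^sup>2 \<le> 0"
    using sub[of v "\<phi> v"] by (simp add: W power2_eq_square algebra_simps)
  then show ?thesis by simp
qed

section \<open>Clipping\<close>

definition clip :: "nat \<Rightarrow> real \<Rightarrow> real" where
  "clip n y = max (- real n) (min (real n) y)"

lemma clip_measurable [measurable]: "clip n \<in> borel_measurable borel"
  unfolding clip_def by measurable

lemma abs_clip_le: "\<bar>clip n y\<bar> \<le> real n"
  by (auto simp: clip_def)

lemma clip_lipschitz: "\<bar>clip n x - clip n y\<bar> \<le> \<bar>x - y\<bar>"
  by (auto simp: clip_def)

lemma clip_tendsto: "(\<lambda>n. clip n y) \<longlonglongrightarrow> y"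
proof (rule tendsto_eventually)
  obtain N where "\<bar>y\<bar> \<le> real N" using real_arch_simple by blast
  then show "\<forall>\<^sub>F n in sequentially. clip n y = y"
    unfolding eventually_sequentially by (intro exI[of _ N]) (auto simp: clip_def)
qed

text \<open>
  Clipping does not change signs, so for a product of nonnegative sign the clipped versions increase;
  monotone convergence will remove the clipping.
\<close>

lemma mono_clip_mult:
  assumes "0 \<le> y * w"
  shows "mono (\<lambda>n. clip n y * w)"
proof (rule monoI)
  fix m n :: nat assume "m \<le> n"
  then have "0 \<le> y \<and> clip m y \<le> clip n y \<or> y \<le> 0 \<and> clip n y \<le> clip m y"
    by (auto simp: clip_def)
  moreover have "y = 0 \<Longrightarrow> clip m y = clip n y" by (simp add: clip_def)
  ultimately show "clip m y * w \<le> clip n y * w"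
    using assms by (auto simp: zero_le_mult_iff intro: mult_right_mono mult_right_mono_neg)
qed

section \<open>The Gaussian channel and its inverse regression\<close>

locale gaussian_channel = prob_space M for M :: "'a measure" +
  fixes V U :: "'a \<Rightarrow> real" and \<phi> P :: "real \<Rightarrow> real"
  assumes V_law: "distributed M lborel V std_normal_density"
    and U_law: "distributed M lborel U std_normal_density"
    and indep: "indep_var borel V borel U"
    and \<phi>_borel [measurable]: "\<phi> \<in> borel_measurable borel"
    and version: "inverse_regression M V U \<phi> P"
begin

abbreviation Y :: "'a \<Rightarrow> real" where "Y \<omega> \<equiv> \<phi> (V \<omega>) + U \<omega>"

abbreviation sigma_Y :: "'a measure" where "sigma_Y \<equiv> vimage_algebra (space M) Y borel"

lemma V_measurable [measurable]: "V \<in> borel_measurable M"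
  using distributed_measurable[OF V_law] by simp

lemma U_measurable [measurable]: "U \<in> borel_measurable M"
  using distributed_measurable[OF U_law] by simp

lemma P_measurable [measurable]: "P \<in> borel_measurable borel"
  using version by (simp add: inverse_regression_def)

lemma distr_V: "distr M borel V = gauss"
  using distributed_distr_eq_density[OF V_law] by (simp add: gauss_def cong: distr_cong)

lemma distr_U: "distr M borel U = gauss"
  using distributed_distr_eq_density[OF U_law] by (simp add: gauss_def cong: distr_cong)

lemma distr_VU: "distr M (borel \<Otimes>\<^sub>M borel) (\<lambda>\<omega>. (V \<omega>, U \<omega>)) = gauss \<Otimes>\<^sub>M gauss"
  using indep unfolding indep_var_distribution_eq distr_V distr_U by simp

lemma V_moments:
  "integrable M V" "expectation V = 0" "integrable M (\<lambda>\<omega>. (V \<omega>)\<^sup>2)" "expectation (\<lambda>\<omega>. (V \<omega>)\<^sup>2) = 1"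
  using gauss_moments unfolding distr_V[symmetric]
  by (simp_all add: integrable_distr_eq integral_distr)

lemma U_moments:
  "integrable M U" "expectation U = 0" "integrable M (\<lambda>\<omega>. (U \<omega>)\<^sup>2)" "expectation (\<lambda>\<omega>. (U \<omega>)\<^sup>2) = 1"
  using gauss_moments unfolding distr_U[symmetric]
  by (simp_all add: integrable_distr_eq integral_distr)

lemma UV_uncorrelated: "integrable M (\<lambda>\<omega>. U \<omega> * V \<omega>)" "expectation (\<lambda>\<omega>. U \<omega> * V \<omega>) = 0"
  using indep_var_integrable[OF indep V_moments(1) U_moments(1)]
    indep_var_lebesgue_integral[OF indep V_moments(1) U_moments(1)]
  by (simp_all add: V_moments mult.commute)

lemma fubini_VU:
  fixes g :: "real \<Rightarrow> real \<Rightarrow> real"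
  assumes [measurable]: "case_prod g \<in> borel_measurable (borel \<Otimes>\<^sub>M borel)"
    and int: "integrable M (\<lambda>\<omega>. g (V \<omega>) (U \<omega>))"
  shows "AE v in gauss. integrable gauss (g v)"
    and "integrable gauss (\<lambda>v. \<integral>u. g v u \<partial>gauss)"
    and "(\<integral>v. \<integral>u. g v u \<partial>gauss \<partial>gauss) = expectation (\<lambda>\<omega>. g (V \<omega>) (U \<omega>))"
proof -
  interpret G: prob_space gauss by (rule prob_space_gauss)
  interpret GG: pair_prob_space gauss gauss ..
  have "integrable (gauss \<Otimes>\<^sub>M gauss) (case_prod g)"
    using int unfolding distr_VU[symmetric] by (subst integrable_distr_eq) auto
  note GG.AE_integrable_fst[OF this] GG.integrable_fst[OF this] GG.integral_fst[OF this]
  moreover have "integral\<^sup>L (gauss \<Otimes>\<^sub>M gauss) (case_prod g) = expectation (\<lambda>\<omega>. g (V \<omega>) (U \<omega>))"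
    unfolding distr_VU[symmetric] by (subst integral_distr) auto
  ultimately show "AE v in gauss. integrable gauss (g v)"
    "integrable gauss (\<lambda>v. \<integral>u. g v u \<partial>gauss)"
    "(\<integral>v. \<integral>u. g v u \<partial>gauss \<partial>gauss) = expectation (\<lambda>\<omega>. g (V \<omega>) (U \<omega>))"
    by simp_all
qed

lemma shifted_expectation_eq_gauss_mean: "shifted_expectation M U P x = gauss_mean P x"
  unfolding shifted_expectation_def gauss_mean_def distr_U[symmetric] by (subst integral_distr) auto

sublocale sigma_Y: finite_measure_subalgebra M sigma_Y
proof (rule finite_measure_subalgebra.intro)
  show "finite_measure_subalgebra_axioms M sigma_Y"
    using sets_image_in_sets[OF refl, of Y M borel] by unfold_locales (simp add: subalgebra_def)
qed (rule finite_measure_axioms)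

lemma Y_measurable [measurable]: "Y \<in> borel_measurable sigma_Y"
  by (rule measurable_vimage_algebra1) simp

lemma regression_AE: "AE \<omega> in M. P (Y \<omega>) = real_cond_exp M sigma_Y V \<omega>"
  using version by (simp add: inverse_regression_def)

lemma cond_exp_square_integrable:
  assumes [measurable]: "Z \<in> borel_measurable M" and "integrable M (\<lambda>\<omega>. (Z \<omega>)\<^sup>2)"
  shows "integrable M (\<lambda>\<omega>. (real_cond_exp M sigma_Y Z \<omega>)\<^sup>2)"
proof (rule sigma_Y.integrable_convex_cond_exp[where I = UNIV and q = "\<lambda>x. x\<^sup>2"])
  show "integrable M Z"
    using square_integrable_imp_integrable[of Z] assms by simp
qed (use assms convex_power2 in auto)

lemma P_square_integrable: "integrable M (\<lambda>\<omega>. (P (Y \<omega>))\<^sup>2)"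
proof -
  have "AE \<omega> in M. (P (Y \<omega>))\<^sup>2 = (real_cond_exp M sigma_Y V \<omega>)\<^sup>2"
    using regression_AE by eventually_elim simp
  then show ?thesis
    using cond_exp_square_integrable[OF V_measurable V_moments(3)]
    by (subst integrable_cong_AE) auto
qed

lemma expectation_mult_regression:
  assumes [measurable]: "Z \<in> borel_measurable sigma_Y" and int: "integrable M (\<lambda>\<omega>. Z \<omega> * V \<omega>)"
  shows "integrable M (\<lambda>\<omega>. Z \<omega> * P (Y \<omega>))"
    and "expectation (\<lambda>\<omega>. Z \<omega> * P (Y \<omega>)) = expectation (\<lambda>\<omega>. Z \<omega> * V \<omega>)"
proof -
  have [measurable]: "Z \<in> borel_measurable M"
    by (rule measurable_from_subalg[OF sigma_Y.subalg assms(1)])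
  have ae: "AE \<omega> in M. Z \<omega> * P (Y \<omega>) = Z \<omega> * real_cond_exp M sigma_Y V \<omega>"
    using regression_AE by eventually_elim simp
  note c = sigma_Y.real_cond_exp_intg[OF int assms(1) V_measurable]
  show "integrable M (\<lambda>\<omega>. Z \<omega> * P (Y \<omega>))"
    using c(1) by (subst integrable_cong_AE[OF _ _ ae]) auto
  show "expectation (\<lambda>\<omega>. Z \<omega> * P (Y \<omega>)) = expectation (\<lambda>\<omega>. Z \<omega> * V \<omega>)"
    using c(2) by (subst integral_cong_AE[OF _ _ ae]) auto
qed

lemma UP_integrable: "integrable M (\<lambda>\<omega>. U \<omega> * P (Y \<omega>))"
  by (rule integrable_mult_of_squares[OF _ _ U_moments(3) P_square_integrable]) auto

text \<open>
  Bessel's inequality in \<open>L\<^sup>2\<close>. The variables \<open>U\<close> and \<open>V\<close> are orthonormal, and \<open>S = E[U | Y]\<close> has coefficients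
  \<open>E[S U] = E[S\<^sup>2]\<close> and \<open>E[S V] = E[S P(Y)] = E[U P(Y)]\<close>. The bound \<open>1/2\<close> is attained when \<open>\<phi>\<close> is the
  identity.
\<close>

lemma expectation_UP_le_half: "expectation (\<lambda>\<omega>. U \<omega> * P (Y \<omega>)) \<le> 1 / 2"
proof -
  define S where "S = real_cond_exp M sigma_Y U"
  have [measurable]: "S \<in> borel_measurable sigma_Y" "S \<in> borel_measurable M"
    unfolding S_def by auto
  define J where "J = expectation (\<lambda>\<omega>. (S \<omega>)\<^sup>2)"
  define p where "p = expectation (\<lambda>\<omega>. U \<omega> * P (Y \<omega>))"
  have S2: "integrable M (\<lambda>\<omega>. (S \<omega>)\<^sup>2)"
    unfolding S_def by (rule cond_exp_square_integrable) (use U_moments in auto)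
  have SU: "integrable M (\<lambda>\<omega>. S \<omega> * U \<omega>)"
    by (rule integrable_mult_of_squares[OF _ _ S2 U_moments(3)]) auto
  have SV: "integrable M (\<lambda>\<omega>. S \<omega> * V \<omega>)"
    by (rule integrable_mult_of_squares[OF _ _ S2 V_moments(3)]) auto
  have eSU: "expectation (\<lambda>\<omega>. S \<omega> * U \<omega>) = J"
    using sigma_Y.real_cond_exp_intg(2)[OF SU] by (simp add: S_def J_def power2_eq_square)
  have "integrable M (\<lambda>\<omega>. P (Y \<omega>) * U \<omega>)" using UP_integrable by (simp add: mult.commute)
  from sigma_Y.real_cond_exp_intg(2)[OF this]
  have "expectation (\<lambda>\<omega>. S \<omega> * P (Y \<omega>)) = p"
    by (simp add: S_def p_def mult.commute)
  then have eSV: "expectation (\<lambda>\<omega>. S \<omega> * V \<omega>) = p"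
    using expectation_mult_regression(2)[OF _ SV] by simp
  have "0 \<le> expectation (\<lambda>\<omega>. (S \<omega> - J * U \<omega> - p * V \<omega>)\<^sup>2)" by simp
  also have "(\<lambda>\<omega>. (S \<omega> - J * U \<omega> - p * V \<omega>)\<^sup>2) = (\<lambda>\<omega>. (S \<omega>)\<^sup>2 + J\<^sup>2 * (U \<omega>)\<^sup>2 + p\<^sup>2 * (V \<omega>)\<^sup>2
      - 2 * J * (S \<omega> * U \<omega>) - 2 * p * (S \<omega> * V \<omega>) + 2 * J * p * (U \<omega> * V \<omega>))"
    by (simp add: fun_eq_iff power2_eq_square algebra_simps)
  also have "expectation \<dots> = J + J\<^sup>2 + p\<^sup>2 - 2 * J * J - 2 * p * p"
    using S2 SU SV UV_uncorrelated U_moments V_moments by (simp add: eSU eSV flip: J_def)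
  finally have "p\<^sup>2 \<le> J - J\<^sup>2" by (simp add: power2_eq_square)
  \<comment> \<open>The maximum of \<open>J - J\<^sup>2\<close> is taken at \<open>J = 1/2\<close>.\<close>
  also have "\<dots> \<le> (1 / 2)\<^sup>2"
    using zero_le_power2[of "J - 1 / 2"] by (simp add: power2_eq_square algebra_simps)
  finally show ?thesis unfolding p_def[symmetric] by (rule power2_le_imp_le) simp
qed

text \<open>
  \<open>P(Y)\<close> and all exponentials of \<open>U\<close> are square integrable, so by Fubini the claim holds around \<open>x = \<phi>(v)\<close> for
  almost every \<open>v\<close>. One such centre is enough. In particular \<open>gauss_mean P\<close> is finite and differentiable everywhere,
  also far from the range of \<open>\<phi>\<close>.
\<close>

lemma P_exp_integrable: "integrable gauss (\<lambda>u. P (x + u) * exp (c * \<bar>u\<bar>))"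
proof -
  have intM: "integrable M (\<lambda>\<omega>. P (Y \<omega>) * exp (real n * \<bar>U \<omega>\<bar>))" for n
  proof (rule integrable_mult_of_squares[OF _ _ P_square_integrable])
    have "integrable (distr M borel U) (\<lambda>u. exp ((2 * real n) * \<bar>u\<bar>))"
      unfolding distr_U by (rule integrable_gauss_exp_abs)
    then show "integrable M (\<lambda>\<omega>. (exp (real n * \<bar>U \<omega>\<bar>))\<^sup>2)"
      by (simp add: integrable_distr_eq power2_eq_square mult.assoc flip: exp_add)
  qed auto
  have "AE v in gauss. integrable gauss (\<lambda>u. P (\<phi> v + u) * exp (real n * \<bar>u\<bar>))" for n
    by (rule fubini_VU(1)[OF _ intM]) measurable
  then have ae: "AE v in lborel. \<forall>n. integrable gauss (\<lambda>u. P (\<phi> v + u) * exp (real n * \<bar>u\<bar>))"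
    unfolding AE_all_countable AE_gauss_iff by blast
  obtain v where v: "\<And>n. integrable gauss (\<lambda>u. P (\<phi> v + u) * exp (real n * \<bar>u\<bar>))"
    by (rule AE_lborel_dense[OF ae zero_less_one]) blast
  have "integrable gauss (\<lambda>u. P (\<phi> v + u) * exp (c * \<bar>u\<bar>))" for c
  proof -
    obtain n where n: "c \<le> real n" using real_arch_simple by blast
    show ?thesis
    proof (rule Bochner_Integration.integrable_bound[OF v[of n]])
      show "AE u in gauss. norm (P (\<phi> v + u) * exp (c * \<bar>u\<bar>)) \<le> norm (P (\<phi> v + u) * exp (real n * \<bar>u\<bar>))"
        using n by (intro AE_I2) (simp add: abs_mult mult_left_mono mult_right_mono)
    qed simp
  qed
  then show ?thesis by (rule exp_integrable_shift[OF P_measurable])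
qed

lemma P_shift_integrable: "integrable gauss (\<lambda>u. P (x + u))"
  using P_exp_integrable[of x 0] by simp

lemma gauss_mean_P_deriv: "(gauss_mean P has_real_derivative gauss_slope P x) (at x)"
  by (rule gauss_mean_deriv[OF P_measurable P_exp_integrable])

lemma slope_expectation:
  "integrable gauss (\<lambda>v. gauss_slope P (\<phi> v))"
  "(\<integral>v. gauss_slope P (\<phi> v) \<partial>gauss) = expectation (\<lambda>\<omega>. U \<omega> * P (Y \<omega>))"
  unfolding gauss_slope_def
  by (rule fubini_VU(2,3)[OF _ UP_integrable], measurable)+

text \<open>
  Formally \<open>E[X (V - P(Y))] = E[Y (V - P(Y))] - E[U (V - P(Y))] = 0 + E[U P(Y)]\<close>. Since \<open>X\<close> may fail to be
  integrable, \<open>X\<close> and \<open>Y\<close> are replaced by \<open>clip n X\<close> and \<open>clip n Y\<close>: these differ by at most \<open>\<bar>U\<bar>\<close>, so the error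
  converges by domination, and the left-hand side converges monotonically because the conditional
  expectation of \<open>clip n X (V - P(Y))\<close> given \<open>V\<close> is nonnegative.
\<close>

lemma value_expectation:
  assumes nonneg: "\<And>v. 0 \<le> \<phi> v * (v - gauss_mean P (\<phi> v))"
  shows "integrable gauss (\<lambda>v. \<phi> v * (v - gauss_mean P (\<phi> v)))"
    and "(\<integral>v. \<phi> v * (v - gauss_mean P (\<phi> v)) \<partial>gauss) = expectation (\<lambda>\<omega>. U \<omega> * P (Y \<omega>))"
proof -
  let ?f = "\<lambda>n v. clip n (\<phi> v) * (v - gauss_mean P (\<phi> v))"
  let ?D = "\<lambda>\<omega>. V \<omega> - P (Y \<omega>)"
  have P1: "integrable M (\<lambda>\<omega>. P (Y \<omega>))"
    using square_integrable_imp_integrable[OF _ P_square_integrable] by simp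
  have D1: "integrable M ?D" using V_moments(1) P1 by simp
  have D2: "integrable M (\<lambda>\<omega>. (?D \<omega>)\<^sup>2)"
  proof -
    have "integrable M (\<lambda>\<omega>. V \<omega> * P (Y \<omega>))"
      by (rule integrable_mult_of_squares[OF _ _ V_moments(3) P_square_integrable]) auto
    moreover have "(\<lambda>\<omega>. (?D \<omega>)\<^sup>2) = (\<lambda>\<omega>. (V \<omega>)\<^sup>2 + (P (Y \<omega>))\<^sup>2 - 2 * (V \<omega> * P (Y \<omega>)))"
      by (simp add: power2_diff ac_simps)
    ultimately show ?thesis using V_moments(3) P_square_integrable by simp
  qed
  have bdd: "integrable M (\<lambda>\<omega>. clip n (g \<omega>) * Z \<omega>)"
    if "integrable M Z" and [measurable]: "g \<in> borel_measurable M" for n g and Z :: "'a \<Rightarrow> real"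
  proof (rule Bochner_Integration.integrable_bound[OF integrable_mult_right[OF that(1), of "real n"]])
    show "AE \<omega> in M. norm (clip n (g \<omega>) * Z \<omega>) \<le> norm (real n * Z \<omega>)"
      using abs_clip_le by (intro AE_I2) (simp add: abs_mult mult_right_mono)
  qed (use that in auto)
  have fn: "integrable gauss (?f n)"
    "integral\<^sup>L gauss (?f n) = expectation (\<lambda>\<omega>. clip n (\<phi> (V \<omega>)) * ?D \<omega>)" for n
  proof -
    have eq: "(\<integral>u. clip n (\<phi> v) * (v - P (\<phi> v + u)) \<partial>gauss) = ?f n v" for v
    proof -
      interpret G: prob_space gauss by (rule prob_space_gauss)
      show ?thesis using P_shift_integrable[of "\<phi> v"] G.prob_space by (simp add: gauss_mean_def)
    qed
    have "integrable M (\<lambda>\<omega>. clip n (\<phi> (V \<omega>)) * ?D \<omega>)" by (rule bdd[OF D1]) simp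
    from fubini_VU(2,3)[of "\<lambda>v u. clip n (\<phi> v) * (v - P (\<phi> v + u))", OF _ this]
    show "integrable gauss (?f n)"
      "integral\<^sup>L gauss (?f n) = expectation (\<lambda>\<omega>. clip n (\<phi> (V \<omega>)) * ?D \<omega>)"
      unfolding eq by simp_all
  qed
  have fn': "integral\<^sup>L gauss (?f n) = expectation (\<lambda>\<omega>. (clip n (\<phi> (V \<omega>)) - clip n (Y \<omega>)) * ?D \<omega>)" for n
  proof -
    have iV: "integrable M (\<lambda>\<omega>. clip n (Y \<omega>) * V \<omega>)" by (rule bdd[OF V_moments(1)]) simp
    have "expectation (\<lambda>\<omega>. clip n (Y \<omega>) * ?D \<omega>) = 0"
      using expectation_mult_regression[OF _ iV] iV by (simp add: right_diff_distrib)
    moreover have "integrable M (\<lambda>\<omega>. clip n (\<phi> (V \<omega>)) * ?D \<omega>)" "integrable M (\<lambda>\<omega>. clip n (Y \<omega>) * ?D \<omega>)"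
      by (rule bdd[OF D1], simp)+
    ultimately show ?thesis unfolding fn left_diff_distrib by simp
  qed
  have "(\<lambda>n. expectation (\<lambda>\<omega>. (clip n (\<phi> (V \<omega>)) - clip n (Y \<omega>)) * ?D \<omega>)) \<longlonglongrightarrow>
      expectation (\<lambda>\<omega>. (\<phi> (V \<omega>) - Y \<omega>) * ?D \<omega>)"
  proof (rule integral_dominated_convergence[where w = "\<lambda>\<omega>. \<bar>U \<omega> * ?D \<omega>\<bar>"])
    show "integrable M (\<lambda>\<omega>. \<bar>U \<omega> * ?D \<omega>\<bar>)"
      by (intro integrable_abs integrable_mult_of_squares[OF _ _ U_moments(3) D2]) auto
    show "AE \<omega> in M. (\<lambda>n. (clip n (\<phi> (V \<omega>)) - clip n (Y \<omega>)) * ?D \<omega>) \<longlonglongrightarrow> (\<phi> (V \<omega>) - Y \<omega>) * ?D \<omega>"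
      by (intro AE_I2 tendsto_intros clip_tendsto)
    show "AE \<omega> in M. norm ((clip n (\<phi> (V \<omega>)) - clip n (Y \<omega>)) * ?D \<omega>) \<le> \<bar>U \<omega> * ?D \<omega>\<bar>" for n
    proof (rule AE_I2)
      fix \<omega>
      have "\<bar>clip n (\<phi> (V \<omega>)) - clip n (Y \<omega>)\<bar> \<le> \<bar>U \<omega>\<bar>"
        using clip_lipschitz[of n "\<phi> (V \<omega>)" "Y \<omega>"] by simp
      then show "norm ((clip n (\<phi> (V \<omega>)) - clip n (Y \<omega>)) * ?D \<omega>) \<le> \<bar>U \<omega> * ?D \<omega>\<bar>"
        by (simp add: abs_mult mult_right_mono)
    qed
  qed auto
  also have "expectation (\<lambda>\<omega>. (\<phi> (V \<omega>) - Y \<omega>) * ?D \<omega>) = expectation (\<lambda>\<omega>. U \<omega> * P (Y \<omega>) - U \<omega> * V \<omega>)"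
    by (simp add: right_diff_distrib)
  also have "\<dots> = expectation (\<lambda>\<omega>. U \<omega> * P (Y \<omega>))"
    using UP_integrable UV_uncorrelated by simp
  finally have lim: "(\<lambda>n. integral\<^sup>L gauss (?f n)) \<longlonglongrightarrow> expectation (\<lambda>\<omega>. U \<omega> * P (Y \<omega>))"
    unfolding fn' .
  have [measurable]: "gauss_mean P \<in> borel_measurable borel"
    by (intro borel_measurable_continuous_onI continuous_at_imp_continuous_on ballI
        DERIV_isCont[OF gauss_mean_P_deriv])
  have m: "AE v in gauss. mono (\<lambda>n. ?f n v)" by (intro AE_I2 mono_clip_mult nonneg)
  have l: "AE v in gauss. (\<lambda>n. ?f n v) \<longlonglongrightarrow> \<phi> v * (v - gauss_mean P (\<phi> v))"
    by (intro AE_I2 tendsto_intros clip_tendsto)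
  show "integrable gauss (\<lambda>v. \<phi> v * (v - gauss_mean P (\<phi> v)))"
    by (rule integrable_monotone_convergence[OF fn(1) m l lim]) measurable
  show "(\<integral>v. \<phi> v * (v - gauss_mean P (\<phi> v)) \<partial>gauss) = expectation (\<lambda>\<omega>. U \<omega> * P (Y \<omega>))"
    by (rule integral_monotone_convergence[OF fn(1) m l lim]) measurable
qed

section \<open>Maximisation forces the identity\<close>

lemma identity_if_maximising:
  assumes opt: "\<And>v x. x * v - x * gauss_mean P x \<le> \<phi> v * v - \<phi> v * gauss_mean P (\<phi> v)"
  shows "\<phi> v = v"
proof -
  define W where "W v = \<phi> v * (v - gauss_mean P (\<phi> v))" for v
  have W0: "0 \<le> W v" for v using opt[of 0 v] by (simp add: W_def algebra_simps)
  have sub: "W u + \<phi> u * (v - u) \<le> W v" for u v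
    using opt[of "\<phi> u" v] by (simp add: W_def algebra_simps)
  \<comment> \<open>The derivative of the objective vanishes at its maximiser.\<close>
  have foc: "v = gauss_mean P (\<phi> v) + \<phi> v * gauss_slope P (\<phi> v)" for v
  proof -
    have "((\<lambda>x. x * v - x * gauss_mean P x) has_real_derivative
        1 * v - (1 * gauss_mean P (\<phi> v) + gauss_slope P (\<phi> v) * \<phi> v)) (at (\<phi> v))"
      by (intro DERIV_diff DERIV_mult gauss_mean_P_deriv DERIV_cmult_right DERIV_ident)
    then have "1 * v - (1 * gauss_mean P (\<phi> v) + gauss_slope P (\<phi> v) * \<phi> v) = 0"
      by (rule DERIV_local_max[OF _ zero_less_one]) (use opt in auto)
    then show ?thesis by (simp add: algebra_simps)
  qed
  have W: "W v = (\<phi> v)\<^sup>2 * gauss_slope P (\<phi> v)" for v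
  proof -
    have "v - gauss_mean P (\<phi> v) = \<phi> v * gauss_slope P (\<phi> v)" using foc[of v] by linarith
    then show ?thesis by (simp add: W_def power2_eq_square)
  qed
  \<comment> \<open>By the first order condition \<open>\<phi>\<close> can vanish only at the single point \<open>gauss_mean P 0\<close>.\<close>
  have "AE v in gauss. v \<noteq> gauss_mean P 0"
    unfolding AE_gauss_iff by (rule AE_lborel_singleton)
  then have nz: "AE v in gauss. \<phi> v \<noteq> 0"
  proof eventually_elim
    case (elim v)
    then show ?case using foc[of v] by auto
  qed
  have val: "integrable gauss W" "(\<integral>v. W v \<partial>gauss) = expectation (\<lambda>\<omega>. U \<omega> * P (Y \<omega>))"
    unfolding W_def by (rule value_expectation; use W0 in \<open>simp add: W_def\<close>)+
  show ?thesis
  proof (rule identity_if_value_plus_slope_le[OF sub W0 W nz val(1) slope_expectation(1)])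
    show "(\<integral>v. W v + gauss_slope P (\<phi> v) \<partial>gauss) \<le> 1"
      using val slope_expectation expectation_UP_le_half by simp
  qed
qed

section \<open>The identity is maximising\<close>

text \<open>
  Exchanging the independent and equally distributed \<open>V\<close> and \<open>U\<close> preserves \<open>Y = V + U\<close>, so \<open>V\<close> and \<open>U\<close> have the same
  conditional expectation given \<open>Y\<close>, and the two add up to \<open>Y\<close>.
\<close>

lemma regression_if_identity:
  assumes id: "\<And>v. \<phi> v = v"
  shows "AE \<omega> in M. P (V \<omega> + U \<omega>) = (V \<omega> + U \<omega>) / 2"
proof -
  interpret G: prob_space gauss by (rule prob_space_gauss)
  interpret GG: pair_prob_space gauss gauss ..
  have "AE \<omega> in M. real_cond_exp M sigma_Y V \<omega> = Y \<omega> / 2"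
  proof (rule sigma_Y.real_cond_exp_charact)
    fix A assume "A \<in> sets sigma_Y"
    then obtain B where B [measurable]: "B \<in> sets borel" and A: "A = Y -` B \<inter> space M"
      by (subst (asm) sets_vimage_algebra2) auto
    have [measurable]: "A \<in> sets M" unfolding A by measurable
    let ?g = "\<lambda>(v, u). indicator B (v + u) * v :: real"
    have swap: "expectation (\<lambda>\<omega>. indicator A \<omega> * V \<omega>) = expectation (\<lambda>\<omega>. indicator A \<omega> * U \<omega>)"
    proof -
      have "expectation (\<lambda>\<omega>. indicator A \<omega> * V \<omega>) = expectation (\<lambda>\<omega>. ?g (V \<omega>, U \<omega>))"
        by (intro Bochner_Integration.integral_cong) (auto simp: A id split: split_indicator)
      also have "\<dots> = integral\<^sup>L (gauss \<Otimes>\<^sub>M gauss) ?g"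
        unfolding distr_VU[symmetric] by (subst integral_distr) auto
      also have "\<dots> = integral\<^sup>L (gauss \<Otimes>\<^sub>M gauss) (\<lambda>(x, y). ?g (y, x))"
        by (rule GG.integral_product_swap[symmetric]) measurable
      also have "\<dots> = expectation (\<lambda>\<omega>. ?g (U \<omega>, V \<omega>))"
        unfolding distr_VU[symmetric] by (subst integral_distr) auto
      also have "\<dots> = expectation (\<lambda>\<omega>. indicator A \<omega> * U \<omega>)"
        by (intro Bochner_Integration.integral_cong) (auto simp: A id add.commute split: split_indicator)
      finally show ?thesis .
    qed
    have "integrable M (\<lambda>\<omega>. indicator A \<omega> * V \<omega>)" "integrable M (\<lambda>\<omega>. indicator A \<omega> * U \<omega>)"
      using integrable_mult_indicator[of A M V] integrable_mult_indicator[of A M U] V_moments U_moments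
      by auto
    then have "expectation (\<lambda>\<omega>. indicator A \<omega> * (Y \<omega> / 2)) = expectation (\<lambda>\<omega>. indicator A \<omega> * V \<omega>)"
      using swap by (simp add: id distrib_left add_divide_distrib)
    then show "(\<integral>\<omega>\<in>A. V \<omega> \<partial>M) = (\<integral>\<omega>\<in>A. Y \<omega> / 2 \<partial>M)"
      by (simp add: set_lebesgue_integral_def)
  next
    show "integrable M V" by (rule V_moments)
    show "integrable M (\<lambda>\<omega>. Y \<omega> / 2)" using V_moments U_moments by (simp add: id)
  qed measurable
  with regression_AE show ?thesis by eventually_elim (simp add: id)
qed

text \<open>
  \<open>P(y) = y / 2\<close> is known for almost every \<open>y\<close> under the law of \<open>v + U\<close> for some \<open>v\<close>. That law has the same
  null sets as the law of \<open>x + U\<close>, whatever \<open>x\<close>.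
\<close>

lemma gauss_mean_if_identity:
  assumes id: "\<And>v. \<phi> v = v"
  shows "gauss_mean P x = x / 2"
proof -
  interpret G: prob_space gauss by (rule prob_space_gauss)
  interpret GG: pair_prob_space gauss gauss ..
  have "AE z in distr M (borel \<Otimes>\<^sub>M borel) (\<lambda>\<omega>. (V \<omega>, U \<omega>)). P (fst z + snd z) = (fst z + snd z) / 2"
    using regression_if_identity[OF id] by (subst AE_distr_iff) auto
  then have "AE z in gauss \<Otimes>\<^sub>M gauss. P (fst z + snd z) = (fst z + snd z) / 2"
    unfolding distr_VU .
  from GG.AE_pair[OF this]
  have ae: "AE v in lborel. AE u in gauss. P (v + u) = (v + u) / 2"
    by (simp add: AE_gauss_iff)
  obtain v where "AE u in gauss. P (v + u) = (v + u) / 2"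
    by (rule AE_lborel_dense[OF ae zero_less_one]) blast
  then have "AE u in gauss. P (x + u) = (x + u) / 2"
    by (rule AE_gauss_shift[rotated]) measurable
  then have "gauss_mean P x = (\<integral>u. (x + u) / 2 \<partial>gauss)"
    unfolding gauss_mean_def by (intro integral_cong_AE) auto
  also have "\<dots> = x / 2"
    using gauss_moments G.prob_space by simp
  finally show ?thesis .
qed

end

theorem theorem7p1:
  fixes M :: "'a measure" and V U :: "'a \<Rightarrow> real" and \<phi> P :: "real \<Rightarrow> real"
  assumes "prob_space M"
    and "distributed M lborel V std_normal_density"
    and "distributed M lborel U std_normal_density"
    and "prob_space.indep_var M borel V borel U"
    and "\<phi> \<in> borel_measurable borel"
    and "inverse_regression M V U \<phi> P"
  shows "(\<forall>v. is_arg_max (\<lambda>x. x * v - x * shifted_expectation M U P x) (\<lambda>x. x \<in> UNIV) (\<phi> v))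
           \<longleftrightarrow> (\<forall>v. \<phi> v = v)"
proof -
  interpret gaussian_channel M V U \<phi> P
    using assms by (simp add: gaussian_channel_def gaussian_channel_axioms_def)
  have iff: "is_arg_max (\<lambda>x. x * v - x * shifted_expectation M U P x) (\<lambda>x. x \<in> UNIV) y \<longleftrightarrow>
      (\<forall>x. x * v - x * gauss_mean P x \<le> y * v - y * gauss_mean P y)" for v y
    by (simp add: is_arg_max_def shifted_expectation_eq_gauss_mean not_less)
  show ?thesis
    unfolding iff
  proof
    assume "\<forall>v x. x * v - x * gauss_mean P x \<le> \<phi> v * v - \<phi> v * gauss_mean P (\<phi> v)"
    then show "\<forall>v. \<phi> v = v" using identity_if_maximising by blast
  next
    assume id: "\<forall>v. \<phi> v = v"
    have "x * v - x * (x / 2) \<le> v * v - v * (v / 2)" for v x :: real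
      using zero_le_power2[of "x - v"] by (simp add: power2_eq_square algebra_simps)
    then show "\<forall>v x. x * v - x * gauss_mean P x \<le> \<phi> v * v - \<phi> v * gauss_mean P (\<phi> v)"
      using id by (simp add: gauss_mean_if_identity)
  qed
qed

end
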